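(* Let $k$ be a rig of characteristic zero and let $\mathbf{A}$ and $\mathbf{A}'$ be patch-finite (small) categories with fine Möbius inversion over $k$. Suppose that $\mathbf{A}$ and $\mathbf{A}'$ have the same underlying directed graph. Then for all objects $a,b$, $$\sum_{f: a\to b}\mu_{\mathbf{A}}(f)=\sum_{f: a\to b}\mu_{\mathbf{A}'}(f),$$ where $\mu_{\mathbf{A}}$ and $\mu_{\mathbf{A}'}$ are the fine Möbius functions and the sums are over all maps (edges) $f$ from $a$ to $b$.
   Context: A rig is a set with a commutative monoid structure $(+,0)$ and a commutative monoid structure $(\cdot,1)$, the latter distributing over the former (including $0\cdot x=0$). It has characteristic zero if $0$ is the only natural number $n$ with $n\cdot 1=0$ in $k$. A category $\mathbf{A}$ is finely finite if for each map $f:a\to b$ there are only finitely many pairs of composable maps $a\xrightarrow{g}c\xrightarrow{h}b$ with $hg=f$. It is patch-finite if it is finely finite and all its hom-sets $\mathbf{A}(a,b)$ are finite. For $\mathbf{A}$ finely finite with set of maps $\mathbf{A}_1$, the fine incidence algebra $k\mathbf{A}$ is the set of functions $\mathbf{A}_1\to k$ with pointwise $k$-module structure and product $(\alpha*\beta)(f)=\sum_{hg=f}\alpha(g)\beta(h)$; the unit $\delta$ is $1$ on identities and $0$ on other maps. The fine zeta function $\zeta_{\mathbf{A}}\in k\mathbf{A}$ is $\zeta_{\mathbf{A}}(f)=1$ for all $f$. $\mathbf{A}$ has fine Möbius inversion over $k$ if $\zeta_{\mathbf{A}}$ has a multiplicative inverse in $k\mathbf{A}$; this inverse $\mu_{\mathbf{A}}$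 is the fine Möbius function. The underlying directed graph of a category consists of its objects (vertices) and maps (edges) with their sources and targets, forgetting composition and identities. *)

theory Defs
  imports "Graph_Theory.Digraph" "HOL-Algebra.Module"
begin

section \<open>Small categories as directed graphs with identities and composition\<close>

text \<open>\<open>comp A h g\<close> is the composite \<open>hg\<close> (first \<open>g\<close>, then \<open>h\<close>). Values of \<open>tail\<close>, \<open>head\<close>,
  \<open>ident\<close> and \<open>comp\<close> outside their mathematical domains are irrelevant.\<close>

record ('a, 'b) cat_data = "('a, 'b) pre_digraph" +
  ident :: "'a \<Rightarrow> 'b"
  comp :: "'b \<Rightarrow> 'b \<Rightarrow> 'b"

text \<open>Source and target are cut down to the actual edges, so that equality of underlying graphs
  does not depend on the values of \<open>tail\<close> and \<open>head\<close> outside \<open>arcs A\<close>.\<close>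

definition underlying_digraph :: "('a, 'b) cat_data \<Rightarrow> ('a, 'b) pre_digraph" where
  "underlying_digraph A =
    \<lparr>verts = verts A, arcs = arcs A,
     tail = restrict (tail A) (arcs A), head = restrict (head A) (arcs A)\<rparr>"

definition hom_set :: "('a, 'b) cat_data \<Rightarrow> 'a \<Rightarrow> 'a \<Rightarrow> 'b set" where
  "hom_set A a b = {f \<in> arcs A. tail A f = a \<and> head A f = b}"

locale small_category =
  fixes A :: "('a, 'b) cat_data"
  assumes wf: "wf_digraph (underlying_digraph A)"
    and ident_in_hom: "a \<in> verts A \<Longrightarrow> ident A a \<in> hom_set A a a"
    and comp_in_hom: "\<lbrakk>g \<in> hom_set A a b; h \<in> hom_set A b c\<rbrakk> \<Longrightarrow> comp A h g \<in> hom_set A a c"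
    and comp_ident_right: "f \<in> hom_set A a b \<Longrightarrow> comp A f (ident A a) = f"
    and comp_ident_left: "f \<in> hom_set A a b \<Longrightarrow> comp A (ident A b) f = f"
    and comp_assoc: "\<lbrakk>f \<in> hom_set A a b; g \<in> hom_set A b c; h \<in> hom_set A c d\<rbrakk>
      \<Longrightarrow> comp A h (comp A g f) = comp A (comp A h g) f"

section \<open>Finiteness conditions\<close>

definition factorizations :: "('a, 'b) cat_data \<Rightarrow> 'b \<Rightarrow> ('b \<times> 'b) set" where
  "factorizations A f =
    {(g, h). g \<in> arcs A \<and> h \<in> arcs A \<and> head A g = tail A h \<and> comp A h g = f}"

definition finely_finite :: "('a, 'b) cat_data \<Rightarrow> bool" where
  "finely_finite A \<longleftrightarrow> (\<forall>f \<in> arcs A. finite (factorizations A f))"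

definition patch_finite :: "('a, 'b) cat_data \<Rightarrow> bool" where
  "patch_finite A \<longleftrightarrow>
    finely_finite A \<and> (\<forall>a \<in> verts A. \<forall>b \<in> verts A. finite (hom_set A a b))"

section \<open>The fine incidence algebra and fine Moebius inversion\<close>

text \<open>A rig (with commutative multiplication) is a type of class \<open>comm_semiring_1\<close>. That class also
  demands \<open>0 \<noteq> 1\<close>, which characteristic zero implies. The condition below is weaker than the class \<open>semiring_char_0\<close>, which requires \<open>of_nat\<close> to be injective;
  the two differ in the absence of additive cancellation.\<close>

definition rig_char_zero :: "'k::comm_semiring_1 itself \<Rightarrow> bool" where
  "rig_char_zero _ \<longleftrightarrow> (\<forall>n::nat. (of_nat n :: 'k) = 0 \<longrightarrow> n = 0)"

text \<open>Functions on the set of maps are represented by extensional functions, so that equality of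
  elements of the algebra is equality on \<open>arcs A\<close>.\<close>

definition fine_zeta :: "('a, 'b) cat_data \<Rightarrow> 'b \<Rightarrow> 'k::comm_semiring_1" where
  "fine_zeta A = (\<lambda>f \<in> arcs A. 1)"

definition fine_delta :: "('a, 'b) cat_data \<Rightarrow> 'b \<Rightarrow> 'k::comm_semiring_1" where
  "fine_delta A = (\<lambda>f \<in> arcs A. if f \<in> ident A ` verts A then 1 else 0)"

definition fine_incidence_algebra ::
    "('a, 'b) cat_data \<Rightarrow> ('k::comm_semiring_1, 'b \<Rightarrow> 'k) module" where
  "fine_incidence_algebra A =
    \<lparr>carrier = arcs A \<rightarrow>\<^sub>E UNIV,
     monoid.mult = (\<lambda>\<alpha> \<beta>. \<lambda>f \<in> arcs A. \<Sum>(g, h) \<in> factorizations A f. \<alpha> g * \<beta> h),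
     one = fine_delta A,
     zero = (\<lambda>f \<in> arcs A. 0),
     add = (\<lambda>\<alpha> \<beta>. \<lambda>f \<in> arcs A. \<alpha> f + \<beta> f),
     smult = (\<lambda>c \<alpha>. \<lambda>f \<in> arcs A. c * \<alpha> f)\<rparr>"

definition has_fine_moebius_inversion ::
    "'k::comm_semiring_1 itself \<Rightarrow> ('a, 'b) cat_data \<Rightarrow> bool" where
  "has_fine_moebius_inversion _ A \<longleftrightarrow>
    fine_zeta A \<in> Units (fine_incidence_algebra A :: ('k, 'b \<Rightarrow> 'k) module)"

definition fine_moebius :: "('a, 'b) cat_data \<Rightarrow> 'b \<Rightarrow> 'k::comm_semiring_1" where
  "fine_moebius A = inv\<^bsub>fine_incidence_algebra A\<^esub> (fine_zeta A)"

end

theory Submission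
  imports Defs
begin

text \<open>
  Summing a function \<open>\<alpha>\<close> on maps over each hom-set gives a matrix indexed by objects, and this
  passage turns convolution into matrix multiplication (\<open>hom_sum_mult\<close>): a composable pair
  \<open>a \<rightarrow> x \<rightarrow> c\<close> contributes to exactly one map \<open>a \<rightarrow> c\<close>, namely its composite. Hence the matrix
  of the Moebius function is a two-sided inverse of the matrix of the zeta function. The entries of
  the latter are the cardinalities of the hom-sets, which depend only on the underlying graph, and
  a two-sided inverse is unique, so two categories on the same graph have the same Moebius matrix.

  The matrices may be infinite, so products have to be kept finite. For the entry at
  \<open>(a, b)\<close> only objects \<open>x\<close> admitting maps \<open>a \<rightarrow> x \<rightarrow> b\<close> matter. There are finitely many of them,
  since each is the middle object of a factorization of one of the finitely many maps \<open>a \<rightarrow> b\<close>;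
  and whatever lies between two of them is again one of them, so the uniqueness argument can be
  carried out with matrices indexed by this finite set.
\<close>

section \<open>The fine incidence algebra is a monoid\<close>

context small_category
begin

lemma hom_setI: "f \<in> arcs A \<Longrightarrow> f \<in> hom_set A (tail A f) (head A f)"
  by (simp add: hom_set_def)

lemma tail_in_verts: "f \<in> arcs A \<Longrightarrow> tail A f \<in> verts A"
  and head_in_verts: "f \<in> arcs A \<Longrightarrow> head A f \<in> verts A"
  using wf_digraph.tail_in_verts[OF wf, of f] wf_digraph.head_in_verts[OF wf, of f]
  by (simp_all add: underlying_digraph_def)

lemma factorizationsD:
  assumes "(g, h) \<in> factorizations A f" and "f \<in> hom_set A a c"
  shows "g \<in> hom_set A a (head A g)" "h \<in> hom_set A (head A g) c" "comp A h g = f"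
    "head A g \<in> verts A"
proof -
  have gh: "g \<in> arcs A" "h \<in> arcs A" "head A g = tail A h" "comp A h g = f"
    using assms(1) by (auto simp: factorizations_def)
  have "f \<in> hom_set A (tail A g) (head A h)"
    using comp_in_hom[of g "tail A g" "head A g" h "head A h"] gh by (simp add: hom_set_def)
  then have "tail A g = a" "head A h = c"
    using assms(2) by (auto simp: hom_set_def)
  then show "g \<in> hom_set A a (head A g)" "h \<in> hom_set A (head A g) c" "comp A h g = f"
    "head A g \<in> verts A"
    using gh head_in_verts[OF gh(1)] by (simp_all add: hom_set_def)
qed

lemma factorizationsI:
  assumes "g \<in> hom_set A a b" and "h \<in> hom_set A b c"
  shows "(g, h) \<in> factorizations A (comp A h g)"
  using assms by (auto simp: factorizations_def hom_set_def)

lemma mult_apply: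
  "f \<in> arcs A \<Longrightarrow> (\<alpha> \<otimes>\<^bsub>fine_incidence_algebra A\<^esub> \<beta>) f =
    (\<Sum>(g, h) \<in> factorizations A f. \<alpha> g * \<beta> h)"
  by (simp add: fine_incidence_algebra_def)

lemma fine_delta_apply:
  assumes "f \<in> hom_set A a b" and "a \<in> verts A"
  shows "fine_delta A f = (if f = ident A a then 1 else 0)"
proof -
  have "f \<in> ident A ` verts A \<longleftrightarrow> f = ident A a"
    using assms ident_in_hom by (auto simp: hom_set_def)
  then show ?thesis
    using assms(1) by (simp add: fine_delta_def hom_set_def)
qed

lemma fine_delta_mult_apply:
  assumes "finely_finite A" and f: "f \<in> hom_set A a b"
  shows "(fine_delta A \<otimes>\<^bsub>fine_incidence_algebra A\<^esub> \<alpha>) f = \<alpha> f"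
proof -
  have farc: "f \<in> arcs A" and a: "a \<in> verts A"
    using f tail_in_verts by (auto simp: hom_set_def)
  have fin: "finite (factorizations A f)"
    using assms(1) farc by (simp add: finely_finite_def)
  have mem: "(ident A a, f) \<in> factorizations A f"
    using factorizationsI[OF ident_in_hom[OF a] f] by (simp add: comp_ident_right[OF f])
  have "(\<Sum>(g, h) \<in> factorizations A f. fine_delta A g * \<alpha> h) =
      (\<Sum>p \<in> factorizations A f. if p = (ident A a, f) then \<alpha> f else 0)"
  proof (rule sum.cong[OF refl], clarify)
    fix g h assume gh: "(g, h) \<in> factorizations A f"
    note D = factorizationsD[OF gh f]
    have "h = f" if "g = ident A a"
    proof -
      have "head A g = a"
        using ident_in_hom[OF a] that by (simp add: hom_set_def)
      then show ?thesis
        using D(2,3) that comp_ident_right by metis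
    qed
    then show "fine_delta A g * \<alpha> h = (if (g, h) = (ident A a, f) then \<alpha> f else 0)"
      by (auto simp: fine_delta_apply[OF D(1) a])
  qed
  then show ?thesis
    using fin mem farc by (simp add: mult_apply)
qed

lemma mult_fine_delta_apply:
  assumes "finely_finite A" and f: "f \<in> hom_set A a b"
  shows "(\<alpha> \<otimes>\<^bsub>fine_incidence_algebra A\<^esub> fine_delta A) f = \<alpha> f"
proof -
  have farc: "f \<in> arcs A" and b: "b \<in> verts A"
    using f head_in_verts by (auto simp: hom_set_def)
  have fin: "finite (factorizations A f)"
    using assms(1) farc by (simp add: finely_finite_def)
  have mem: "(f, ident A b) \<in> factorizations A f"
    using factorizationsI[OF f ident_in_hom[OF b]] by (simp add: comp_ident_left[OF f])
  have "(\<Sum>(g, h) \<in> factorizations A f. \<alpha> g * fine_delta A h) =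
      (\<Sum>p \<in> factorizations A f. if p = (f, ident A b) then \<alpha> f else 0)"
  proof (rule sum.cong[OF refl], clarify)
    fix g h assume gh: "(g, h) \<in> factorizations A f"
    note D = factorizationsD[OF gh f]
    have "(h = ident A (head A g)) = (g = f \<and> h = ident A b)"
    proof
      assume h: "h = ident A (head A g)"
      then have "head A g = b"
        using ident_in_hom[OF D(4)] D(2) by (simp add: hom_set_def)
      then show "g = f \<and> h = ident A b"
        using D(1,3) h comp_ident_left by metis
    next
      assume "g = f \<and> h = ident A b"
      then show "h = ident A (head A g)"
        using f by (simp add: hom_set_def)
    qed
    then show "\<alpha> g * fine_delta A h = (if (g, h) = (f, ident A b) then \<alpha> f else 0)"
      by (simp add: fine_delta_apply[OF D(2,4)])
  qed
  then show ?thesis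
    using fin mem farc by (simp add: mult_apply)
qed

text \<open>Both sides sum over the ways of writing \<open>f\<close> as a composite of three maps \<open>p\<close>, \<open>q\<close>, \<open>h\<close>.\<close>

lemma mult_assoc_apply:
  assumes ff: "finely_finite A" and f: "f \<in> arcs A"
  shows "((\<alpha> \<otimes>\<^bsub>fine_incidence_algebra A\<^esub> \<beta>) \<otimes>\<^bsub>fine_incidence_algebra A\<^esub> \<gamma>) f =
    (\<alpha> \<otimes>\<^bsub>fine_incidence_algebra A\<^esub> (\<beta> \<otimes>\<^bsub>fine_incidence_algebra A\<^esub> \<gamma>)) f"
proof -
  let ?F = "factorizations A"
  have fin: "finite (?F g)" if "g \<in> arcs A" for g
    using ff that by (simp add: finely_finite_def)
  have arcs: "g \<in> arcs A" "h \<in> arcs A" if "(g, h) \<in> ?F f'" for g h f'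
    using that by (auto simp: factorizations_def)
  have "((\<alpha> \<otimes>\<^bsub>fine_incidence_algebra A\<^esub> \<beta>) \<otimes>\<^bsub>fine_incidence_algebra A\<^esub> \<gamma>) f =
      (\<Sum>x \<in> ?F f. \<Sum>y \<in> ?F (fst x). \<alpha> (fst y) * \<beta> (snd y) * \<gamma> (snd x))"
    by (auto simp: mult_apply[OF f] mult_apply arcs case_prod_unfold sum_distrib_right
        intro!: sum.cong)
  also have "\<dots> = (\<Sum>(x, y) \<in> (SIGMA x:?F f. ?F (fst x)).
      \<alpha> (fst y) * \<beta> (snd y) * \<gamma> (snd x))"
    using fin f arcs by (intro sum.Sigma) auto
  also have "\<dots> = (\<Sum>(x, y) \<in> (SIGMA x:?F f. ?F (snd x)).
      \<alpha> (fst x) * (\<beta> (fst y) * \<gamma> (snd y)))"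
  proof (rule sum.reindex_bij_witness[where
        j = "\<lambda>((g, h), (p, q)). ((p, comp A h q), (q, h))" and
        i = "\<lambda>((p, r), (q, h)). ((comp A q p, h), (p, q))"], goal_cases)
    case (2 t)
    then obtain g h p q where t: "t = ((g, h), (p, q))"
      and gh: "(g, h) \<in> ?F f" and pq: "(p, q) \<in> ?F g"
      by auto
    note D = factorizationsD[OF gh hom_setI[OF f]]
    note E = factorizationsD[OF pq D(1)]
    show ?case
      using factorizationsI[OF E(1) comp_in_hom[OF E(2) D(2)]] factorizationsI[OF E(2) D(2)]
        comp_assoc[OF E(1,2) D(2)] E(3) D(3) by (simp add: t)
  next
    case (4 t)
    then obtain p r q h where t: "t = ((p, r), (q, h))"
      and pr: "(p, r) \<in> ?F f" and qh: "(q, h) \<in> ?F r"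
      by auto
    note D = factorizationsD[OF pr hom_setI[OF f]]
    note E = factorizationsD[OF qh D(2)]
    show ?case
      using factorizationsI[OF comp_in_hom[OF D(1) E(1)] E(2)] factorizationsI[OF D(1) E(1)]
        comp_assoc[OF D(1) E(1,2)] E(3) D(3) by (simp add: t)
  qed (auto simp: factorizations_def mult.assoc)
  also have "\<dots> = (\<Sum>x \<in> ?F f. \<Sum>y \<in> ?F (snd x). \<alpha> (fst x) * (\<beta> (fst y) * \<gamma> (snd y)))"
    using fin f arcs by (intro sum.Sigma[symmetric]) auto
  also have "\<dots> = (\<alpha> \<otimes>\<^bsub>fine_incidence_algebra A\<^esub> (\<beta> \<otimes>\<^bsub>fine_incidence_algebra A\<^esub> \<gamma>)) f"
    by (auto simp: mult_apply[OF f] mult_apply arcs case_prod_unfold sum_distrib_left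
        intro!: sum.cong)
  finally show ?thesis .
qed

lemma monoid_fine_incidence_algebra:
  assumes "finely_finite A"
  shows "monoid (fine_incidence_algebra A :: ('k::comm_semiring_1, 'b \<Rightarrow> 'k) module)"
    (is "monoid ?R")
proof (rule monoidI)
  have ext: "\<alpha> = \<beta>"
    if "\<alpha> \<in> carrier ?R" "\<beta> \<in> carrier ?R" "\<And>f. f \<in> arcs A \<Longrightarrow> \<alpha> f = \<beta> f" for \<alpha> \<beta>
    using that by (auto simp: fine_incidence_algebra_def intro: PiE_ext)
  show closed: "\<alpha> \<otimes>\<^bsub>?R\<^esub> \<beta> \<in> carrier ?R" for \<alpha> \<beta>
    by (simp add: fine_incidence_algebra_def)
  show one: "\<one>\<^bsub>?R\<^esub> \<in> carrier ?R"
    by (simp add: fine_incidence_algebra_def fine_delta_def)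
  have one_eq: "\<one>\<^bsub>?R\<^esub> = fine_delta A"
    by (simp add: fine_incidence_algebra_def)
  show "\<alpha> \<otimes>\<^bsub>?R\<^esub> \<beta> \<otimes>\<^bsub>?R\<^esub> \<gamma> = \<alpha> \<otimes>\<^bsub>?R\<^esub> (\<beta> \<otimes>\<^bsub>?R\<^esub> \<gamma>)" for \<alpha> \<beta> \<gamma>
    using closed mult_assoc_apply[OF assms] by (intro ext) auto
  show "\<one>\<^bsub>?R\<^esub> \<otimes>\<^bsub>?R\<^esub> \<alpha> = \<alpha>" if "\<alpha> \<in> carrier ?R" for \<alpha>
    using that closed fine_delta_mult_apply[OF assms hom_setI] one_eq by (intro ext) auto
  show "\<alpha> \<otimes>\<^bsub>?R\<^esub> \<one>\<^bsub>?R\<^esub> = \<alpha>" if "\<alpha> \<in> carrier ?R" for \<alpha>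
    using that closed mult_fine_delta_apply[OF assms hom_setI] one_eq by (intro ext) auto
qed

text \<open>Inverses in a monoid are given by a \<open>THE\<close> term, so the two equations below need
  uniqueness of inverses, which rests on the associativity of convolution.\<close>

lemma
  assumes "finely_finite A" and "has_fine_moebius_inversion TYPE('k::comm_semiring_1) A"
  shows fine_moebius_mult_zeta:
      "fine_moebius A \<otimes>\<^bsub>fine_incidence_algebra A\<^esub> fine_zeta A = (fine_delta A :: 'b \<Rightarrow> 'k)"
    and fine_zeta_mult_moebius:
      "fine_zeta A \<otimes>\<^bsub>fine_incidence_algebra A\<^esub> fine_moebius A = (fine_delta A :: 'b \<Rightarrow> 'k)"
proof -
  let ?R = "fine_incidence_algebra A :: ('k, 'b \<Rightarrow> 'k) module"
  interpret R: monoid ?R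
    by (rule monoid_fine_incidence_algebra[OF assms(1)])
  have unit: "fine_zeta A \<in> Units ?R"
    using assms(2) by (simp add: has_fine_moebius_inversion_def)
  have one: "\<one>\<^bsub>?R\<^esub> = fine_delta A"
    by (simp add: fine_incidence_algebra_def)
  show "fine_moebius A \<otimes>\<^bsub>?R\<^esub> fine_zeta A = fine_delta A"
    using R.Units_l_inv[OF unit] one by (simp add: fine_moebius_def)
  show "fine_zeta A \<otimes>\<^bsub>?R\<^esub> fine_moebius A = fine_delta A"
    using R.Units_r_inv[OF unit] one by (simp add: fine_moebius_def)
qed

end

section \<open>Summation over hom-sets\<close>

definition hom_sum :: "('a, 'b) cat_data \<Rightarrow> ('b \<Rightarrow> 'k::comm_semiring_1) \<Rightarrow> 'a \<Rightarrow> 'a \<Rightarrow> 'k" where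
  "hom_sum A \<alpha> a b = (\<Sum>f \<in> hom_set A a b. \<alpha> f)"

definition objects_between :: "('a, 'b) cat_data \<Rightarrow> 'a \<Rightarrow> 'a \<Rightarrow> 'a set" where
  "objects_between A a b = {x \<in> verts A. hom_set A a x \<noteq> {} \<and> hom_set A x b \<noteq> {}}"

context small_category
begin

lemma hom_sum_fine_delta:
  assumes "patch_finite A" and "a \<in> verts A" and "b \<in> verts A"
  shows "hom_sum A (fine_delta A) a b = (if a = b then 1 else 0)"
proof -
  have "hom_sum A (fine_delta A) a b = (\<Sum>f \<in> hom_set A a b. if f = ident A a then 1 else 0)"
    unfolding hom_sum_def using assms(2) by (intro sum.cong refl fine_delta_apply)
  also have "\<dots> = (if ident A a \<in> hom_set A a b then 1 else 0)"
    using assms by (simp add: patch_finite_def)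
  also have "ident A a \<in> hom_set A a b \<longleftrightarrow> a = b"
    using ident_in_hom[OF assms(2)] by (auto simp: hom_set_def)
  finally show ?thesis .
qed

lemma finite_objects_between:
  assumes "patch_finite A" and "a \<in> verts A" and "b \<in> verts A"
  shows "finite (objects_between A a b)"
proof (rule finite_subset)
  show "objects_between A a b \<subseteq>
      (\<lambda>(g, h). head A g) ` (\<Union>f \<in> hom_set A a b. factorizations A f)"
  proof
    fix x assume "x \<in> objects_between A a b"
    then obtain g h where gh: "g \<in> hom_set A a x" "h \<in> hom_set A x b"
      by (auto simp: objects_between_def)
    have "head A g = x"
      using gh by (simp add: hom_set_def)
    then show "x \<in> (\<lambda>(g, h). head A g) ` (\<Union>f \<in> hom_set A a b. factorizations A f)"
      using comp_in_hom[OF gh] factorizationsI[OF gh] by force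
  qed
  show "finite ((\<lambda>(g, h). head A g) ` (\<Union>f \<in> hom_set A a b. factorizations A f))"
    using assms by (auto simp: patch_finite_def finely_finite_def hom_set_def)
qed

lemma objects_between_mono:
  assumes "x \<in> objects_between A a b" and "y \<in> objects_between A a b"
  shows "objects_between A x y \<subseteq> objects_between A a b"
  using assms comp_in_hom unfolding objects_between_def by blast

lemma ends_in_objects_between:
  assumes "a \<in> verts A" and "b \<in> verts A" and "hom_set A a b \<noteq> {}"
  shows "a \<in> objects_between A a b" "b \<in> objects_between A a b"
  using assms ident_in_hom by (auto simp: objects_between_def)

text \<open>Composition identifies the pairs \<open>a \<rightarrow> x \<rightarrow> c\<close>, over all \<open>x\<close>, with the maps \<open>a \<rightarrow> c\<close>
  equipped with a factorization. Allowing any finite set of objects that contains those between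
  \<open>a\<close> and \<open>c\<close> makes it possible to use a single index set for different entries.\<close>

lemma hom_sum_mult:
  assumes pf: "patch_finite A" and a: "a \<in> verts A" and c: "c \<in> verts A"
    and J: "finite J" "J \<subseteq> verts A" "objects_between A a c \<subseteq> J"
  shows "hom_sum A (\<alpha> \<otimes>\<^bsub>fine_incidence_algebra A\<^esub> \<beta>) a c =
    (\<Sum>x \<in> J. hom_sum A \<alpha> a x * hom_sum A \<beta> x c)"
proof -
  let ?F = "factorizations A" and ?H = "hom_set A"
  have finF: "finite (?F f)" if "f \<in> ?H a c" for f
    using pf that by (simp add: patch_finite_def finely_finite_def hom_set_def)
  have finH: "finite (?H x y)" if "x \<in> verts A" "y \<in> verts A" for x y
    using pf that by (simp add: patch_finite_def)
  have "hom_sum A (\<alpha> \<otimes>\<^bsub>fine_incidence_algebra A\<^esub> \<beta>) a c =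
      (\<Sum>f \<in> ?H a c. \<Sum>p \<in> ?F f. \<alpha> (fst p) * \<beta> (snd p))"
    by (auto simp: hom_sum_def mult_apply hom_set_def case_prod_unfold intro!: sum.cong)
  also have "\<dots> = (\<Sum>(f, p) \<in> (SIGMA f:?H a c. ?F f). \<alpha> (fst p) * \<beta> (snd p))"
    using finF finH[OF a c] by (intro sum.Sigma) auto
  also have "\<dots> = (\<Sum>(x, p) \<in> (SIGMA x:J. ?H a x \<times> ?H x c). \<alpha> (fst p) * \<beta> (snd p))"
  proof (rule sum.reindex_bij_witness[where
        j = "\<lambda>(f, p). (head A (fst p), p)" and
        i = "\<lambda>(x, p). (comp A (snd p) (fst p), p)"], goal_cases)
    case (1 t)
    then show ?case
      by (auto dest: factorizationsD(3))
  next
    case (2 t)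
    then obtain f g h where t: "t = (f, (g, h))" and f: "f \<in> ?H a c" and gh: "(g, h) \<in> ?F f"
      by auto
    note D = factorizationsD[OF gh f]
    have "head A g \<in> J"
      using D J(3) by (auto simp: objects_between_def)
    then show ?case
      using D by (simp add: t)
  next
    case (3 t)
    then show ?case
      by (auto simp: hom_set_def)
  next
    case (4 t)
    then show ?case
      by (auto intro: comp_in_hom factorizationsI)
  qed auto
  also have "\<dots> = (\<Sum>x \<in> J. \<Sum>p \<in> ?H a x \<times> ?H x c. \<alpha> (fst p) * \<beta> (snd p))"
    using J finH a c by (intro sum.Sigma[symmetric]) auto
  also have "\<dots> = (\<Sum>x \<in> J. hom_sum A \<alpha> a x * hom_sum A \<beta> x c)"
    by (simp add: hom_sum_def sum_product sum.cartesian_product case_prod_unfold)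
  finally show ?thesis .
qed

lemma
  assumes "patch_finite A" and "has_fine_moebius_inversion TYPE('k::comm_semiring_1) A"
    and "a \<in> verts A" and "c \<in> verts A"
    and "finite J" and "J \<subseteq> verts A" and "objects_between A a c \<subseteq> J"
  shows sum_moebius_zeta:
      "(\<Sum>x \<in> J. hom_sum A (fine_moebius A) a x * hom_sum A (fine_zeta A) x c) =
        (if a = c then 1 else 0 :: 'k)"
    and sum_zeta_moebius:
      "(\<Sum>x \<in> J. hom_sum A (fine_zeta A) a x * hom_sum A (fine_moebius A) x c) =
        (if a = c then 1 else 0 :: 'k)"
proof -
  have ff: "finely_finite A"
    using assms(1) by (simp add: patch_finite_def)
  note mult = hom_sum_mult[OF assms(1,3-7), symmetric]
  note delta = hom_sum_fine_delta[OF assms(1,3,4)]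
  show "(\<Sum>x \<in> J. hom_sum A (fine_moebius A) a x * hom_sum A (fine_zeta A) x c) =
      (if a = c then 1 else 0 :: 'k)"
    unfolding mult fine_moebius_mult_zeta[OF ff assms(2)] by (rule delta)
  show "(\<Sum>x \<in> J. hom_sum A (fine_zeta A) a x * hom_sum A (fine_moebius A) x c) =
      (if a = c then 1 else 0 :: 'k)"
    unfolding mult fine_zeta_mult_moebius[OF ff assms(2)] by (rule delta)
qed

end

section \<open>Independence of the composition\<close>

lemma
  assumes "underlying_digraph A = underlying_digraph A'"
  shows verts_eq_if_underlying_digraph_eq: "verts A = verts A'"
    and hom_set_eq_if_underlying_digraph_eq: "hom_set A = hom_set A'"
proof -
  show "verts A = verts A'"
    using assms by (simp add: underlying_digraph_def)
  have arcs: "arcs A = arcs A'"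
    and "restrict (tail A) (arcs A) = restrict (tail A') (arcs A')"
    and "restrict (head A) (arcs A) = restrict (head A') (arcs A')"
    using assms unfolding underlying_digraph_def by simp_all metis+
  then have "tail A f = tail A' f" "head A f = head A' f" if "f \<in> arcs A" for f
    using that by (metis restrict_apply')+
  then show "hom_set A = hom_set A'"
    using arcs by (auto simp: hom_set_def fun_eq_iff)
qed

text \<open>This is the usual \<open>m = m (z m') = (m z) m' = m'\<close> for matrices indexed by \<open>J\<close>,
  restricted to one row of \<open>m\<close> and one column of \<open>m'\<close>.\<close>

lemma left_inverse_eq_right_inverse_entry:
  fixes m z m' :: "'a \<Rightarrow> 'a \<Rightarrow> 'k::comm_semiring_1"
  assumes J: "finite J" "a \<in> J" "b \<in> J"
    and left: "\<And>y. y \<in> J \<Longrightarrow> (\<Sum>x \<in> J. m a x * z x y) = (if a = y then 1 else 0)"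
    and right: "\<And>x. x \<in> J \<Longrightarrow> (\<Sum>y \<in> J. z x y * m' y b) = (if x = b then 1 else 0)"
  shows "m a b = m' a b"
proof -
  have "m a b = (\<Sum>x \<in> J. if x = b then m a x else 0)"
    using J by simp
  also have "\<dots> = (\<Sum>x \<in> J. m a x * (if x = b then 1 else 0))"
    by (intro sum.cong) auto
  also have "\<dots> = (\<Sum>x \<in> J. m a x * (\<Sum>y \<in> J. z x y * m' y b))"
    by (simp add: right)
  also have "\<dots> = (\<Sum>x \<in> J. \<Sum>y \<in> J. m a x * z x y * m' y b)"
    by (simp add: sum_distrib_left mult.assoc)
  also have "\<dots> = (\<Sum>y \<in> J. \<Sum>x \<in> J. m a x * z x y * m' y b)"
    by (rule sum.swap)
  also have "\<dots> = (\<Sum>y \<in> J. (if a = y then 1 else 0) * m' y b)"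
    by (simp add: left flip: sum_distrib_right)
  also have "\<dots> = (\<Sum>y \<in> J. if a = y then m' y b else 0)"
    by (intro sum.cong) auto
  also have "\<dots> = m' a b"
    using J by simp
  finally show ?thesis .
qed

theorem corollary3p10:
  fixes A A' :: "('a, 'b) cat_data"
  assumes "rig_char_zero TYPE('k::comm_semiring_1)"
    and "small_category A" and "small_category A'"
    and "patch_finite A" and "patch_finite A'"
    and "has_fine_moebius_inversion TYPE('k) A"
    and "has_fine_moebius_inversion TYPE('k) A'"
    and "underlying_digraph A = underlying_digraph A'"
    and "a \<in> verts A" and "b \<in> verts A"
  shows "(\<Sum>f \<in> hom_set A a b. (fine_moebius A f :: 'k)) =
    (\<Sum>f \<in> hom_set A' a b. fine_moebius A' f)"
proof (cases "hom_set A a b = {}")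
  case True
  then show ?thesis
    by (simp flip: hom_set_eq_if_underlying_digraph_eq[OF assms(8)])
next
  case False
  interpret A: small_category A by fact
  interpret A': small_category A' by fact
  have verts: "verts A' = verts A" and hom: "hom_set A' = hom_set A"
    using verts_eq_if_underlying_digraph_eq[OF assms(8)]
      hom_set_eq_if_underlying_digraph_eq[OF assms(8)] by simp_all
  \<comment> \<open>Nonemptiness of the hom-set is what puts \<open>a\<close> and \<open>b\<close> themselves into the index set.\<close>
  define J where "J = objects_between A a b"
  have J: "finite J" "J \<subseteq> verts A" and ends: "a \<in> J" "b \<in> J"
    using A.finite_objects_between[OF assms(4,9,10)] A.ends_in_objects_between[OF assms(9,10) False]
    by (auto simp: J_def objects_between_def)
  have between: "objects_between A x y \<subseteq> J" if "x \<in> J" "y \<in> J" for x y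
    using A.objects_between_mono that by (simp add: J_def)
  have between': "objects_between A' = objects_between A"
    by (simp add: objects_between_def verts hom fun_eq_iff)
  have zeta: "hom_sum A' (fine_zeta A') = (hom_sum A (fine_zeta A) :: 'a \<Rightarrow> 'a \<Rightarrow> 'k)"
  proof (intro ext)
    fix x y
    have "hom_set A x y \<subseteq> arcs A" "hom_set A x y \<subseteq> arcs A'"
      using hom[THEN fun_cong, THEN fun_cong, of x y] by (auto simp: hom_set_def)
    then show "hom_sum A' (fine_zeta A') x y = (hom_sum A (fine_zeta A) x y :: 'k)"
      by (auto simp: hom_sum_def hom fine_zeta_def intro!: sum.cong)
  qed
  have "hom_sum A (fine_moebius A) a b = (hom_sum A' (fine_moebius A') a b :: 'k)"
  proof (rule left_inverse_eq_right_inverse_entry[OF J(1) ends])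
    show "(\<Sum>x \<in> J. hom_sum A (fine_moebius A) a x * hom_sum A (fine_zeta A) x y) =
        (if a = y then 1 else 0 :: 'k)" if "y \<in> J" for y
      using A.sum_moebius_zeta[OF assms(4,6,9)] J between ends that by blast
    show "(\<Sum>y \<in> J. hom_sum A (fine_zeta A) x y * hom_sum A' (fine_moebius A') y b) =
        (if x = b then 1 else 0 :: 'k)" if "x \<in> J" for x
      using A'.sum_zeta_moebius[OF assms(5,7), of x b J] J between[OF that ends(2)] that assms(10)
      by (auto simp: verts between' zeta)
  qed
  then show ?thesis
    by (simp add: hom_sum_def)
qed

end
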